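(* Let $\mathcal{C} = (E, \mathcal{A}, \pi, \mathit{ok}, \vdash, \Vdash)$ be a contract. For every event $e \in E$: $e$ is reachable in $\mathcal{C}$ if and only if $[\mathcal{C}] \vdash_{\mathrm{PCL}} \pi(e) \;\mathit{says}\; e$.
   Context: A contract is a 6-tuple $\mathcal{C} = (E, \mathcal{A}, \pi, \mathit{ok}, \vdash, \Vdash)$ where $E$ is a finite set of events, $\mathcal{A}$ is a finite set of participants, $\pi : E \to \mathcal{A}$, $\mathit{ok} \subseteq \mathcal{A} \times \mathcal{P}(E)$ is upward closed in its second argument, and $\vdash, \Vdash \subseteq \mathcal{P}(E) \times E$ are saturated: $X \circ e$ and $X \subseteq Y$ imply $Y \circ e$ for $\circ \in \{\vdash, \Vdash\}$. A set $C \subseteq E$ is a configuration iff there exist $e_0, \ldots, e_n$ with $\{e_0,\ldots,e_n\} = C$ such that for every $i \le n$, either $\{e_0,\ldots,e_{i-1}\} \vdash e_i$ or $C \Vdash e_i$. An event is reachable if it belongs to some configuration. Propositional Contract Logic (PCL): formulae are built from atoms (here: the events of $E$), $\top$, the intuitionistic connectives ($\wedge, \vee, \rightarrow, \bot$), a binary connective $\twoheadrightarrow$ (contractual implication), and unary modalities $A \;\mathit{says}\; \varphi$ indexed by principals $A$ (here: participants). Provability $\Gamma \vdash_{\mathrm{PCL}} \varphi$ is given by the Hilbert system consisting of all axioms of intuitionistic propositional logic, modus ponens, and the axioms $\top \twoheadrightarrow \top$; $(\varphi \twoheadrightarrow \varphi) \rightarrow \varphi$; $(\varphi' \rightarrow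 \varphi) \rightarrow (\varphi \twoheadrightarrow \psi) \rightarrow (\psi \rightarrow \psi') \rightarrow (\varphi' \twoheadrightarrow \psi')$; $\varphi \rightarrow (A \;\mathit{says}\; \varphi)$; $(A \;\mathit{says}\; A \;\mathit{says}\; \varphi) \rightarrow A \;\mathit{says}\; \varphi$; $(\varphi \rightarrow \psi) \rightarrow (A \;\mathit{says}\; \varphi) \rightarrow (A \;\mathit{says}\; \psi)$. Translation of contracts: for $\circ \in \{\vdash, \Vdash\}$ and a pair $\{d_i : i \in I\} \circ a$, set $[\{d_i : i \in I\} \circ a] = \pi(a) \;\mathit{says}\; \big( (\bigwedge_{i \in I} \pi(d_i) \;\mathit{says}\; d_i) \,[\circ]\, a \big)$, where $[\vdash] = \rightarrow$, $[\Vdash] = \twoheadrightarrow$, and the empty conjunction is $\top$. Then $[\mathcal{C}]$ is the conjunction of $[D \circ a]$ over all pairs $(D,a)$ in $\vdash$ and in $\Vdash$. *)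

theory Defs
  imports Main "HOL-Library.FuncSet"
begin

section \<open>Contracts\<close>

record ('e, 'p) contract =
  events :: "'e set"
  participants :: "'p set"
  owner :: "'e \<Rightarrow> 'p"
  ok :: "('p \<times> 'e set) set"
  enab :: "('e set \<times> 'e) set"  \<comment> \<open>the enabling relation \<open>\<turnstile>\<close>\<close>
  cenab :: "('e set \<times> 'e) set"  \<comment> \<open>the circular enabling relation \<open>\<tturnstile>\<close>\<close>

definition saturated :: "'e set \<Rightarrow> ('e set \<times> 'e) set \<Rightarrow> bool" where
  "saturated E R \<longleftrightarrow> (\<forall>X Y e. (X, e) \<in> R \<and> X \<subseteq> Y \<and> Y \<subseteq> E \<longrightarrow> (Y, e) \<in> R)"

definition is_contract :: "('e, 'p) contract \<Rightarrow> bool" where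
  "is_contract C \<longleftrightarrow>
     finite (events C) \<and>
     finite (participants C) \<and>
     owner C \<in> events C \<rightarrow> participants C \<and>
     ok C \<subseteq> participants C \<times> Pow (events C) \<and>
     (\<forall>A X Y. (A, X) \<in> ok C \<and> X \<subseteq> Y \<and> Y \<subseteq> events C \<longrightarrow> (A, Y) \<in> ok C) \<and>
     enab C \<subseteq> Pow (events C) \<times> events C \<and> saturated (events C) (enab C) \<and>
     cenab C \<subseteq> Pow (events C) \<times> events C \<and> saturated (events C) (cenab C)"

text \<open>The empty sequence is admitted, so the empty set is a configuration;
  this has no influence on which events are reachable.\<close>

definition configuration :: "('e, 'p) contract \<Rightarrow> 'e set \<Rightarrow> bool" where
  "configuration C X \<longleftrightarrow> X \<subseteq> events C \<and>
     (\<exists>es. set es = X \<and>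
        (\<forall>i < length es. (set (take i es), es ! i) \<in> enab C \<or> (X, es ! i) \<in> cenab C))"

definition reachable :: "('e, 'p) contract \<Rightarrow> 'e \<Rightarrow> bool" where
  "reachable C e \<longleftrightarrow> (\<exists>X. configuration C X \<and> e \<in> X)"


section \<open>Propositional Contract Logic\<close>

datatype (atoms: 'e, principals: 'p) pcl =
    Atom 'e
  | Top  (\<open>\<^bold>\<top>\<close>)
  | Bot  (\<open>\<^bold>\<bottom>\<close>)
  | And "('e, 'p) pcl" "('e, 'p) pcl"  (infixr \<open>\<^bold>\<and>\<close> 55)
  | Or "('e, 'p) pcl" "('e, 'p) pcl"  (infixr \<open>\<^bold>\<or>\<close> 54)
  | Imp "('e, 'p) pcl" "('e, 'p) pcl"  (infixr \<open>\<^bold>\<longrightarrow>\<close> 53)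
  | CImp "('e, 'p) pcl" "('e, 'p) pcl"  (infixr \<open>\<twoheadrightarrow>\<close> 53)
  | Says 'p "('e, 'p) pcl"  (infixr \<open>says\<close> 60)

inductive pcl_axiom :: "('e, 'p) pcl \<Rightarrow> bool" where
  imp_K: "pcl_axiom (\<phi> \<^bold>\<longrightarrow> \<psi> \<^bold>\<longrightarrow> \<phi>)"
| imp_S: "pcl_axiom ((\<phi> \<^bold>\<longrightarrow> \<psi> \<^bold>\<longrightarrow> \<chi>) \<^bold>\<longrightarrow> (\<phi> \<^bold>\<longrightarrow> \<psi>) \<^bold>\<longrightarrow> \<phi> \<^bold>\<longrightarrow> \<chi>)"
| and_I: "pcl_axiom (\<phi> \<^bold>\<longrightarrow> \<psi> \<^bold>\<longrightarrow> \<phi> \<^bold>\<and> \<psi>)"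
| and_E1: "pcl_axiom (\<phi> \<^bold>\<and> \<psi> \<^bold>\<longrightarrow> \<phi>)"
| and_E2: "pcl_axiom (\<phi> \<^bold>\<and> \<psi> \<^bold>\<longrightarrow> \<psi>)"
| or_I1: "pcl_axiom (\<phi> \<^bold>\<longrightarrow> \<phi> \<^bold>\<or> \<psi>)"
| or_I2: "pcl_axiom (\<psi> \<^bold>\<longrightarrow> \<phi> \<^bold>\<or> \<psi>)"
| or_E: "pcl_axiom ((\<phi> \<^bold>\<longrightarrow> \<chi>) \<^bold>\<longrightarrow> (\<psi> \<^bold>\<longrightarrow> \<chi>) \<^bold>\<longrightarrow> \<phi> \<^bold>\<or> \<psi> \<^bold>\<longrightarrow> \<chi>)"
| bot_E: "pcl_axiom (\<^bold>\<bottom> \<^bold>\<longrightarrow> \<phi>)"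
| top_I: "pcl_axiom \<^bold>\<top>"
| cimp_top: "pcl_axiom (\<^bold>\<top> \<twoheadrightarrow> \<^bold>\<top>)"
| cimp_fix: "pcl_axiom ((\<phi> \<twoheadrightarrow> \<phi>) \<^bold>\<longrightarrow> \<phi>)"
| cimp_mono: "pcl_axiom ((\<phi>' \<^bold>\<longrightarrow> \<phi>) \<^bold>\<longrightarrow> (\<phi> \<twoheadrightarrow> \<psi>) \<^bold>\<longrightarrow> (\<psi> \<^bold>\<longrightarrow> \<psi>') \<^bold>\<longrightarrow> (\<phi>' \<twoheadrightarrow> \<psi>'))"
| says_I: "pcl_axiom (\<phi> \<^bold>\<longrightarrow> (A says \<phi>))"
| says_join: "pcl_axiom ((A says A says \<phi>) \<^bold>\<longrightarrow> (A says \<phi>))"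
| says_mono: "pcl_axiom ((\<phi> \<^bold>\<longrightarrow> \<psi>) \<^bold>\<longrightarrow> (A says \<phi>) \<^bold>\<longrightarrow> (A says \<psi>))"

text \<open>The formulae with atoms in \<open>E\<close> and principals in \<open>P\<close>. Derivations only use axiom
  instances from this language, so they never mention objects of the underlying types
  that are not events or participants.\<close>

definition pcl_lang :: "'e set \<Rightarrow> 'p set \<Rightarrow> ('e, 'p) pcl set" where
  "pcl_lang E P = {\<phi>. atoms \<phi> \<subseteq> E \<and> principals \<phi> \<subseteq> P}"

inductive pcl_provable ::
  "'e set \<Rightarrow> 'p set \<Rightarrow> ('e, 'p) pcl set \<Rightarrow> ('e, 'p) pcl \<Rightarrow> bool"
  for E P \<Gamma> where
  hyp: "\<phi> \<in> \<Gamma> \<Longrightarrow> pcl_provable E P \<Gamma> \<phi>"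
| ax: "pcl_axiom \<phi> \<Longrightarrow> \<phi> \<in> pcl_lang E P \<Longrightarrow> pcl_provable E P \<Gamma> \<phi>"
| mp: "pcl_provable E P \<Gamma> (\<phi> \<^bold>\<longrightarrow> \<psi>) \<Longrightarrow> pcl_provable E P \<Gamma> \<phi> \<Longrightarrow> pcl_provable E P \<Gamma> \<psi>"


section \<open>Translation of contracts\<close>

fun conj_list :: "('e, 'p) pcl list \<Rightarrow> ('e, 'p) pcl" where
  "conj_list [] = \<^bold>\<top>"
| "conj_list [\<phi>] = \<phi>"
| "conj_list (\<phi> # \<psi> # \<phi>s) = \<phi> \<^bold>\<and> conj_list (\<psi> # \<phi>s)"

text \<open>The conjunction of a finite set of formulae, in an arbitrary order; different orders
  yield interderivable formulae. The value is meaningful only for finite sets.\<close>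

definition big_conj :: "('e, 'p) pcl set \<Rightarrow> ('e, 'p) pcl" where
  "big_conj S = conj_list (SOME \<phi>s. distinct \<phi>s \<and> set \<phi>s = S)"

text \<open>The first argument of \<open>clause\<close> is the connective translating the enabling relation.\<close>

definition clause ::
  "(('e, 'p) pcl \<Rightarrow> ('e, 'p) pcl \<Rightarrow> ('e, 'p) pcl) \<Rightarrow> ('e \<Rightarrow> 'p) \<Rightarrow> 'e set \<Rightarrow> 'e \<Rightarrow> ('e, 'p) pcl"
  where
  "clause arrow own D a =
     own a says (arrow (big_conj ((\<lambda>d. own d says Atom d) ` D)) (Atom a))"

definition contract_formula :: "('e, 'p) contract \<Rightarrow> ('e, 'p) pcl" where
  "contract_formula C = big_conj
     ({clause Imp (owner C) D a | D a. (D, a) \<in> enab C} \<union>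
      {clause CImp (owner C) D a | D a. (D, a) \<in> cenab C})"

end

theory Submission
  imports Defs
begin

text \<open>
  If \<open>X\<close> is a configuration listed as \<open>e\<^sub>0, \<dots>, e\<^sub>n\<close>, downward induction on \<open>i\<close> shows that
  the statements \<open>\<pi>(e\<^sub>j) says e\<^sub>j\<close> with \<open>j < i\<close> prove all those of \<open>X\<close>: for an event
  enabled circularly, \<open>\<Phi> \<twoheadrightarrow> a\<close> and \<open>a \<rightarrow> \<Phi>\<close> give \<open>\<Phi> \<twoheadrightarrow> \<Phi>\<close>, hence \<open>\<Phi>\<close>, where \<open>\<Phi>\<close> is the
  conjunction over all of \<open>X\<close>.

  Conversely, PCL is sound for intuitionistic Kripke models when \<open>says\<close> is the identity and
  \<open>\<phi> \<twoheadrightarrow> \<psi>\<close> is read as \<open>(\<psi> \<rightarrow> \<phi>) \<rightarrow> \<psi>\<close>. Take as worlds the sets of events that already contain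
  every event reachable from them, ordered by inclusion; then the contract holds everywhere,
  and the least world consists of the reachable events.
\<close>

section \<open>Derivations in PCL\<close>

lemma pcl_lang_simps [simp]:
  "Atom a \<in> pcl_lang E P \<longleftrightarrow> a \<in> E"
  "\<^bold>\<top> \<in> pcl_lang E P"
  "\<^bold>\<bottom> \<in> pcl_lang E P"
  "\<phi> \<^bold>\<and> \<psi> \<in> pcl_lang E P \<longleftrightarrow> \<phi> \<in> pcl_lang E P \<and> \<psi> \<in> pcl_lang E P"
  "\<phi> \<^bold>\<or> \<psi> \<in> pcl_lang E P \<longleftrightarrow> \<phi> \<in> pcl_lang E P \<and> \<psi> \<in> pcl_lang E P"
  "(\<phi> \<^bold>\<longrightarrow> \<psi>) \<in> pcl_lang E P \<longleftrightarrow> \<phi> \<in> pcl_lang E P \<and> \<psi> \<in> pcl_lang E P"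
  "(\<phi> \<twoheadrightarrow> \<psi>) \<in> pcl_lang E P \<longleftrightarrow> \<phi> \<in> pcl_lang E P \<and> \<psi> \<in> pcl_lang E P"
  "(A says \<phi>) \<in> pcl_lang E P \<longleftrightarrow> A \<in> P \<and> \<phi> \<in> pcl_lang E P"
  by (auto simp: pcl_lang_def)

text \<open>The order picked by \<open>SOME\<close> is dealt with here once; later arguments see
  only some list with the right set of entries.\<close>

lemma big_conj_eq_conj_list:
  assumes "finite S"
  obtains \<phi>s where "set \<phi>s = S" "big_conj S = conj_list \<phi>s"
proof -
  have "\<exists>\<phi>s. distinct \<phi>s \<and> set \<phi>s = S"
    using finite_distinct_list[OF assms] by blast
  from someI_ex[OF this] show thesis
    by (intro that) (auto simp: big_conj_def)
qed

lemma conj_list_in_lang: "set \<phi>s \<subseteq> pcl_lang E P \<Longrightarrow> conj_list \<phi>s \<in> pcl_lang E P"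
  by (induction \<phi>s rule: conj_list.induct) auto

lemma big_conj_in_lang:
  "finite S \<Longrightarrow> S \<subseteq> pcl_lang E P \<Longrightarrow> big_conj S \<in> pcl_lang E P"
  by (metis big_conj_eq_conj_list conj_list_in_lang)

context
  fixes E :: "'e set" and P :: "'p set"
begin

abbreviation derives :: "('e, 'p) pcl set \<Rightarrow> ('e, 'p) pcl \<Rightarrow> bool"  (infix \<open>\<turnstile>\<close> 40) where
  "\<Gamma> \<turnstile> \<phi> \<equiv> pcl_provable E P \<Gamma> \<phi>"

text \<open>Recovers from a given derivation the language side conditions that \<open>ax\<close>
  imposes on further axiom instances.\<close>

lemma derives_in_lang: "\<Gamma> \<turnstile> \<phi> \<Longrightarrow> \<Gamma> \<subseteq> pcl_lang E P \<Longrightarrow> \<phi> \<in> pcl_lang E P"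
  by (induction rule: pcl_provable.induct) auto

lemma derives_weaken: "\<Gamma> \<turnstile> \<phi> \<Longrightarrow> \<Gamma> \<subseteq> \<Delta> \<Longrightarrow> \<Delta> \<turnstile> \<phi>"
  by (induction rule: pcl_provable.induct) (auto intro: pcl_provable.intros)

lemma derives_insert: "\<Gamma> \<turnstile> \<psi> \<Longrightarrow> insert \<phi> \<Gamma> \<turnstile> \<psi>"
  by (erule derives_weaken) auto

lemma derives_imp_refl:
  assumes "\<phi> \<in> pcl_lang E P"
  shows "\<Gamma> \<turnstile> \<phi> \<^bold>\<longrightarrow> \<phi>"
  by (rule mp[OF mp[OF ax[OF imp_S[of \<phi> "\<phi> \<^bold>\<longrightarrow> \<phi>" \<phi>]] ax[OF imp_K]] ax[OF imp_K]])
    (use assms in auto)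

text \<open>The language assumption is there for the instances of \<open>imp_K\<close> and
  \<open>imp_S\<close> that carry \<phi> through the derivation: \<open>ax\<close> admits them only
  inside the language.\<close>

lemma deduction:
  assumes "insert \<phi> \<Gamma> \<turnstile> \<psi>" "insert \<phi> \<Gamma> \<subseteq> pcl_lang E P"
  shows "\<Gamma> \<turnstile> \<phi> \<^bold>\<longrightarrow> \<psi>"
  using assms
proof (induction rule: pcl_provable.induct)
  case (hyp \<psi>)
  show ?case
  proof (cases "\<psi> = \<phi>")
    case True
    then show ?thesis using hyp by (auto intro: derives_imp_refl)
  next
    case False
    then have "\<Gamma> \<turnstile> \<psi>"
      using hyp by (auto intro: pcl_provable.hyp)
    then show ?thesis
      by (rule mp[OF ax[OF imp_K], rotated]) (use hyp in auto)
  qed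
next
  case (ax \<psi>)
  from pcl_provable.ax[OF this(1,2)] show ?case
    by (rule mp[OF pcl_provable.ax[OF imp_K], rotated]) (use ax in auto)
next
  case (mp \<chi> \<psi>)
  then have "(\<chi> \<^bold>\<longrightarrow> \<psi>) \<in> pcl_lang E P"
    using derives_in_lang by blast
  with mp have "\<Gamma> \<turnstile> (\<phi> \<^bold>\<longrightarrow> \<chi> \<^bold>\<longrightarrow> \<psi>) \<^bold>\<longrightarrow> (\<phi> \<^bold>\<longrightarrow> \<chi>) \<^bold>\<longrightarrow> \<phi> \<^bold>\<longrightarrow> \<psi>"
    by (intro ax imp_S) auto
  with mp show ?case
    by (blast intro: pcl_provable.mp)
qed

text \<open>Each use of the hypothesis \<phi> is replaced by its derivation.\<close>

lemma derives_cut: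
  assumes "\<Gamma> \<turnstile> \<phi>" "insert \<phi> \<Gamma> \<turnstile> \<psi>"
  shows "\<Gamma> \<turnstile> \<psi>"
  using assms(2,1)
  by (induction rule: pcl_provable.induct) (auto intro: pcl_provable.intros)

lemma derives_says:
  assumes "\<Gamma> \<turnstile> \<phi>" "\<Gamma> \<subseteq> pcl_lang E P" "A \<in> P"
  shows "\<Gamma> \<turnstile> A says \<phi>"
  by (rule mp[OF ax[OF says_I] assms(1)]) (use assms derives_in_lang[OF assms(1,2)] in auto)

text \<open>Monadic bind for \<open>A says\<close>: \<open>says_mono\<close> lifts the implication
  obtained by \<open>deduction\<close>, and \<open>says_join\<close> flattens the doubled modality.
  It permits reasoning from the bare \<phi> as long as the goal is said by the same
  principal.\<close>

lemma derives_says_bind: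
  assumes "\<Gamma> \<turnstile> A says \<phi>" "insert \<phi> \<Gamma> \<turnstile> A says \<psi>" "\<Gamma> \<subseteq> pcl_lang E P"
  shows "\<Gamma> \<turnstile> A says \<psi>"
proof -
  have \<phi>: "A \<in> P" "\<phi> \<in> pcl_lang E P"
    using derives_in_lang[OF assms(1,3)] by auto
  then have \<psi>: "\<psi> \<in> pcl_lang E P"
    using derives_in_lang[OF assms(2)] assms(3) by auto
  have "\<Gamma> \<turnstile> \<phi> \<^bold>\<longrightarrow> A says \<psi>"
    using assms \<phi> by (intro deduction) auto
  then have "\<Gamma> \<turnstile> A says A says \<psi>"
    by (rule mp[OF mp[OF ax[OF says_mono]] assms(1), rotated]) (use \<phi> \<psi> in auto)
  then show ?thesis
    by (rule mp[OF ax[OF says_join], rotated]) (use \<phi> \<psi> in auto)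
qed

text \<open>\<open>cimp_mono\<close> moves the target of the contractual implication from \<psi> to
  \<phi>, where \<open>cimp_fix\<close> applies.\<close>

lemma derives_cimp_fix:
  assumes "\<Gamma> \<turnstile> \<phi> \<twoheadrightarrow> \<psi>" "insert \<psi> \<Gamma> \<turnstile> \<phi>" "\<Gamma> \<subseteq> pcl_lang E P"
  shows "\<Gamma> \<turnstile> \<phi>"
proof -
  have lang: "\<phi> \<in> pcl_lang E P" "\<psi> \<in> pcl_lang E P"
    using derives_in_lang[OF assms(1,3)] by auto
  have "\<Gamma> \<turnstile> \<psi> \<^bold>\<longrightarrow> \<phi>"
    using assms lang by (intro deduction) auto
  then have "\<Gamma> \<turnstile> \<phi> \<twoheadrightarrow> \<phi>"
    by (rule mp[OF mp[OF mp[OF ax[OF cimp_mono] derives_imp_refl] assms(1)], rotated 2])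
      (use lang in auto)
  then show ?thesis
    by (rule mp[OF ax[OF cimp_fix], rotated]) (use lang in auto)
qed

section \<open>Introduction and elimination of finite conjunctions\<close>

lemma derives_conj_listI:
  assumes "\<And>\<phi>. \<phi> \<in> set \<phi>s \<Longrightarrow> \<Gamma> \<turnstile> \<phi>" "\<Gamma> \<subseteq> pcl_lang E P"
  shows "\<Gamma> \<turnstile> conj_list \<phi>s"
  using assms
proof (induction \<phi>s rule: conj_list.induct)
  case 1
  then show ?case by (auto intro: ax top_I)
next
  case (3 \<phi> \<psi> \<phi>s)
  then have *: "\<Gamma> \<turnstile> \<phi>" "\<Gamma> \<turnstile> conj_list (\<psi> # \<phi>s)" by auto
  have "\<Gamma> \<turnstile> \<phi> \<^bold>\<and> conj_list (\<psi> # \<phi>s)"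
    by (rule mp[OF mp[OF ax[OF and_I] *(1)] *(2)]) (use *[THEN derives_in_lang] 3(3) in auto)
  then show ?case by simp
qed auto

lemma derives_conj_listE:
  assumes "\<Gamma> \<turnstile> conj_list \<phi>s" "\<phi> \<in> set \<phi>s" "\<Gamma> \<subseteq> pcl_lang E P"
  shows "\<Gamma> \<turnstile> \<phi>"
  using assms
proof (induction \<phi>s rule: conj_list.induct)
  case (3 \<chi> \<psi> \<phi>s)
  have "\<chi> \<^bold>\<and> conj_list (\<psi> # \<phi>s) \<in> pcl_lang E P"
    using derives_in_lang[OF 3(2,4)] by simp
  moreover have *: "\<Gamma> \<turnstile> \<chi> \<^bold>\<and> conj_list (\<psi> # \<phi>s)"
    using 3(2) by simp
  ultimately have "\<Gamma> \<turnstile> \<chi>" "\<Gamma> \<turnstile> conj_list (\<psi> # \<phi>s)"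
    using mp[OF ax[OF and_E1] *] mp[OF ax[OF and_E2] *] by auto
  with 3 show ?case by auto
qed auto

lemma derives_big_conjI:
  assumes "\<And>\<phi>. \<phi> \<in> S \<Longrightarrow> \<Gamma> \<turnstile> \<phi>" "finite S" "\<Gamma> \<subseteq> pcl_lang E P"
  shows "\<Gamma> \<turnstile> big_conj S"
  using assms by (metis big_conj_eq_conj_list derives_conj_listI)

lemma derives_big_conjE:
  assumes "\<Gamma> \<turnstile> big_conj S" "\<phi> \<in> S" "finite S" "\<Gamma> \<subseteq> pcl_lang E P"
  shows "\<Gamma> \<turnstile> \<phi>"
  using assms by (metis big_conj_eq_conj_list derives_conj_listE)

end

section \<open>Reachable events are provable\<close>

lemma is_contractD:
  assumes "is_contract C"
  shows "finite (events C)"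
    and "\<And>a. a \<in> events C \<Longrightarrow> owner C a \<in> participants C"
    and "\<And>D a. (D, a) \<in> enab C \<Longrightarrow> D \<subseteq> events C \<and> a \<in> events C"
    and "\<And>D a. (D, a) \<in> cenab C \<Longrightarrow> D \<subseteq> events C \<and> a \<in> events C"
    and "\<And>D D' a. (D, a) \<in> enab C \<Longrightarrow> D \<subseteq> D' \<Longrightarrow> D' \<subseteq> events C \<Longrightarrow> (D', a) \<in> enab C"
    and "\<And>D D' a. (D, a) \<in> cenab C \<Longrightarrow> D \<subseteq> D' \<Longrightarrow> D' \<subseteq> events C \<Longrightarrow> (D', a) \<in> cenab C"
proof -
  show "finite (events C)"
    using assms by (simp add: is_contract_def)
  show "owner C a \<in> participants C" if "a \<in> events C" for a
    using assms that by (auto simp: is_contract_def)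
  show "D \<subseteq> events C \<and> a \<in> events C" if "(D, a) \<in> enab C" for D a
    using assms that by (auto simp: is_contract_def)
  show "D \<subseteq> events C \<and> a \<in> events C" if "(D, a) \<in> cenab C" for D a
    using assms that by (auto simp: is_contract_def)
  have sat: "saturated (events C) (enab C)" "saturated (events C) (cenab C)"
    using assms by (simp_all add: is_contract_def)
  show "(D', a) \<in> enab C" if "(D, a) \<in> enab C" "D \<subseteq> D'" "D' \<subseteq> events C" for D D' a
    using sat(1) that unfolding saturated_def by blast
  show "(D', a) \<in> cenab C" if "(D, a) \<in> cenab C" "D \<subseteq> D'" "D' \<subseteq> events C" for D D' a
    using sat(2) that unfolding saturated_def by blast
qed

definition clauses :: "('e, 'p) contract \<Rightarrow> ('e, 'p) pcl set" where
  "clauses C = {clause Imp (owner C) D a | D a. (D, a) \<in> enab C} \<union>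
     {clause CImp (owner C) D a | D a. (D, a) \<in> cenab C}"

lemma contract_formula_eq: "contract_formula C = big_conj (clauses C)"
  by (simp add: contract_formula_def clauses_def)

text \<open>Needed because \<open>big_conj\<close> is a genuine conjunction only on finite
  sets.\<close>

lemma finite_clauses:
  assumes "is_contract C"
  shows "finite (clauses C)"
proof -
  have "finite (Pow (events C) \<times> events C)"
    using assms by (simp add: is_contract_def)
  then have "finite (enab C)" "finite (cenab C)"
    using assms unfolding is_contract_def by (auto intro: finite_subset)
  then have "finite ((\<lambda>(D, a). clause Imp (owner C) D a) ` enab C \<union>
      (\<lambda>(D, a). clause CImp (owner C) D a) ` cenab C)"
    by blast
  then show ?thesis
    by (rule rev_finite_subset) (auto simp: clauses_def)
qed

abbreviation claim :: "('e, 'p) contract \<Rightarrow> 'e \<Rightarrow> ('e, 'p) pcl" where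
  "claim C a \<equiv> owner C a says Atom a"

lemma claims_in_lang:
  assumes "is_contract C" "D \<subseteq> events C"
  shows "claim C ` D \<subseteq> pcl_lang (events C) (participants C)"
  using assms is_contractD(2)[OF assms(1)] by auto

lemma finite_claims: "is_contract C \<Longrightarrow> D \<subseteq> events C \<Longrightarrow> finite (claim C ` D)"
  using is_contractD(1) finite_subset by blast

lemma clauses_in_lang:
  assumes "is_contract C"
  shows "clauses C \<subseteq> pcl_lang (events C) (participants C)"
proof -
  have "big_conj (claim C ` D) \<in> pcl_lang (events C) (participants C)" if "D \<subseteq> events C" for D
    using assms that by (simp add: big_conj_in_lang finite_claims claims_in_lang)
  then show ?thesis
    using is_contractD(2-4)[OF assms] by (auto simp: clauses_def clause_def)
qed

lemma reachable_imp_provable: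
  fixes C :: "('e, 'p) contract"
  assumes C: "is_contract C" and "reachable C e"
  shows "pcl_provable (events C) (participants C) {contract_formula C} (claim C e)"
proof -
  define E P where "E = events C" and "P = participants C"
  obtain es where E: "set es \<subseteq> E" and "e \<in> set es"
    and es: "\<And>i. i < length es \<Longrightarrow>
      (set (take i es), es ! i) \<in> enab C \<or> (set es, es ! i) \<in> cenab C"
    using assms(2) unfolding reachable_def configuration_def E_def by blast
  \<comment> \<open>The contract together with the claims of the first \<open>i\<close> events; at 0
    only the contract is left.\<close>
  define \<Gamma> where "\<Gamma> i = insert (contract_formula C) (claim C ` set (take i es))" for i
  have \<Gamma>_lang: "\<Gamma> i \<subseteq> pcl_lang E P" for i
    using big_conj_in_lang[OF finite_clauses clauses_in_lang, OF C C]
      claims_in_lang[OF C, of "set (take i es)"] E set_take_subset[of i es]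
    by (auto simp: \<Gamma>_def E_def P_def contract_formula_eq)
  have \<Gamma>_clause: "pcl_provable E P (\<Gamma> i) \<phi>" if "\<phi> \<in> clauses C" for i \<phi>
    by (rule derives_big_conjE[OF _ that finite_clauses[OF C] \<Gamma>_lang])
      (auto simp: \<Gamma>_def contract_formula_eq intro: hyp)
  \<comment> \<open>The induction runs down from \<open>length es\<close>, where every claim is a
    hypothesis. Each step derives the claim of \<open>es ! i\<close> from \<open>\<Gamma> i\<close>
    and cuts it out of \<open>\<Gamma> (Suc i)\<close>.\<close>
  have all: "\<forall>x \<in> set es. pcl_provable E P (\<Gamma> i) (claim C x)" if "i \<le> length es" for i
    using that
  proof (induction rule: inc_induct)
    case base
    then show ?case by (auto simp: \<Gamma>_def intro: hyp)
  next
    case (step i)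
    define a where "a = es ! i"
    define \<Phi> where "\<Phi> D = big_conj (claim C ` D)" for D
    have "a \<in> set es" using step by (simp add: a_def)
    then have a: "a \<in> set es" "a \<in> E" "owner C a \<in> P"
      using E is_contractD(2)[OF C] by (auto simp: E_def P_def)
    have \<Gamma>_Suc: "\<Gamma> (Suc i) = insert (claim C a) (\<Gamma> i)"
      using step by (auto simp: \<Gamma>_def a_def take_Suc_conv_app_nth)
    have \<Phi>_lang: "\<Phi> D \<in> pcl_lang E P" if "D \<subseteq> E" for D
      using that big_conj_in_lang[OF finite_claims claims_in_lang, OF C _ C]
      by (auto simp: \<Phi>_def E_def P_def)
    have \<Phi>_I: "pcl_provable E P \<Delta> (\<Phi> D)"
      if "\<And>x. x \<in> D \<Longrightarrow> pcl_provable E P \<Delta> (claim C x)" "\<Delta> \<subseteq> pcl_lang E P" "finite D" for D \<Delta>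
      unfolding \<Phi>_def by (rule derives_big_conjI) (use that in auto)
    have "pcl_provable E P (\<Gamma> i) (claim C a)"
      using es[OF step(2)]
    proof
      let ?D = "set (take i es)"
      assume "(set (take i es), es ! i) \<in> enab C"
      then have "pcl_provable E P (\<Gamma> i) (owner C a says (\<Phi> ?D \<^bold>\<longrightarrow> Atom a))"
        by (intro \<Gamma>_clause) (auto simp: clauses_def clause_def a_def \<Phi>_def)
      moreover have "pcl_provable E P (\<Gamma> i) (\<Phi> ?D)"
        by (rule \<Phi>_I[OF _ \<Gamma>_lang]) (auto simp: \<Gamma>_def intro: hyp)
      then have "pcl_provable E P (insert (\<Phi> ?D \<^bold>\<longrightarrow> Atom a) (\<Gamma> i)) (Atom a)"
        by (blast intro: mp derives_insert hyp)
      \<comment> \<open>The bare atom is turned into a claim because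
        \<open>derives_says_bind\<close> opens the clause only for goals said by the owner of
        \<open>a\<close>.\<close>
      then have "pcl_provable E P (insert (\<Phi> ?D \<^bold>\<longrightarrow> Atom a) (\<Gamma> i)) (claim C a)"
        by (rule derives_says)
          (use \<Gamma>_lang a \<Phi>_lang[of ?D] E set_take_subset[of i es] in auto)
      ultimately show ?thesis
        using \<Gamma>_lang by (rule derives_says_bind)
    next
      let ?X = "set es"
      \<comment> \<open>The body of the circular clause, used as a hypothesis under the
        modality.\<close>
      let ?\<Delta> = "insert (\<Phi> ?X \<twoheadrightarrow> Atom a) (\<Gamma> i)"
      have \<Delta>_lang: "?\<Delta> \<subseteq> pcl_lang E P"
        using \<Gamma>_lang a \<Phi>_lang[OF E] by auto
      assume "(?X, es ! i) \<in> cenab C"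
      then have "pcl_provable E P (\<Gamma> i) (owner C a says (\<Phi> ?X \<twoheadrightarrow> Atom a))"
        by (intro \<Gamma>_clause) (auto simp: clauses_def clause_def a_def \<Phi>_def)
      moreover have "pcl_provable E P (insert (Atom a) ?\<Delta>) (\<Phi> ?X)"
      proof (rule \<Phi>_I)
        fix x assume "x \<in> ?X"
        \<comment> \<open>With the claim of \<open>a\<close> added, the context contains
          \<open>\<Gamma> (Suc i)\<close>, so the induction hypothesis applies. The claim is then
          cut, since \<open>Atom a\<close> yields it by \<open>says_I\<close>.\<close>
        then have "pcl_provable E P (insert (claim C a) (insert (Atom a) ?\<Delta>)) (claim C x)"
          using step(3) unfolding \<Gamma>_Suc
          by (blast intro: derives_weaken)
        moreover have "pcl_provable E P (insert (Atom a) ?\<Delta>) (claim C a)"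
          using \<Delta>_lang a by (intro derives_says) (auto intro: hyp)
        ultimately show "pcl_provable E P (insert (Atom a) ?\<Delta>) (claim C x)"
          by (blast intro: derives_cut)
      qed (use \<Delta>_lang a in auto)
      then have "pcl_provable E P ?\<Delta> (\<Phi> ?X)"
        using \<Delta>_lang by (blast intro: derives_cimp_fix hyp)
      \<comment> \<open>As \<open>a\<close> itself occurs in \<open>es\<close>, its claim is one of
        the conjuncts just proved.\<close>
      then have "pcl_provable E P ?\<Delta> (claim C a)"
        unfolding \<Phi>_def
        by (rule derives_big_conjE) (use a \<Delta>_lang in \<open>auto simp: \<Phi>_def\<close>)
      ultimately show ?thesis
        using \<Gamma>_lang by (blast intro: derives_says_bind)
    qed
    then show ?case
      using step(3) unfolding \<Gamma>_Suc by (blast intro: derives_cut)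
  qed
  from all[of 0] \<open>e \<in> set es\<close> show ?thesis
    by (simp add: \<Gamma>_def E_def P_def)
qed

section \<open>Kripke semantics\<close>

text \<open>A world serves as its own valuation, so atoms persist along inclusion by
  definition.\<close>

primrec forces :: "'e set set \<Rightarrow> 'e set \<Rightarrow> ('e, 'p) pcl \<Rightarrow> bool" where
  "forces W w (Atom a) \<longleftrightarrow> a \<in> w"
| "forces W w \<^bold>\<top> \<longleftrightarrow> True"
| "forces W w \<^bold>\<bottom> \<longleftrightarrow> False"
| "forces W w (\<phi> \<^bold>\<and> \<psi>) \<longleftrightarrow> forces W w \<phi> \<and> forces W w \<psi>"
| "forces W w (\<phi> \<^bold>\<or> \<psi>) \<longleftrightarrow> forces W w \<phi> \<or> forces W w \<psi>"
| "forces W w (\<phi> \<^bold>\<longrightarrow> \<psi>) \<longleftrightarrow> (\<forall>v\<in>W. w \<subseteq> v \<longrightarrow> forces W v \<phi> \<longrightarrow> forces W v \<psi>)"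
| "forces W w (\<phi> \<twoheadrightarrow> \<psi>) \<longleftrightarrow> (\<forall>v\<in>W. w \<subseteq> v \<longrightarrow>
     (\<forall>u\<in>W. v \<subseteq> u \<longrightarrow> forces W u \<psi> \<longrightarrow> forces W u \<phi>) \<longrightarrow> forces W v \<psi>)"
| "forces W w (A says \<phi>) \<longleftrightarrow> forces W w \<phi>"

lemma forces_mono: "forces W w \<phi> \<Longrightarrow> w \<subseteq> v \<Longrightarrow> v \<in> W \<Longrightarrow> forces W v \<phi>"
proof (induction \<phi>)
  case (Imp \<phi> \<psi>)
  then show ?case by (meson forces.simps(6) subset_trans)
next
  case (CImp \<phi> \<psi>)
  then show ?case by (meson forces.simps(7) subset_trans)
qed auto

text \<open>Persistence enters through \<open>imp_K\<close> and \<open>and_I\<close>. The axiom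
  \<open>cimp_fix\<close> holds because the premise \<phi> \<longrightarrow> \<phi> of its
  antecedent is true in every world, and the modal axioms collapse since \<open>says\<close> is the
  identity.\<close>

lemma forces_axiom:
  assumes "pcl_axiom \<phi>" "w \<in> W"
  shows "forces W w \<phi>"
  using assms
proof (induction rule: pcl_axiom.induct)
  case (imp_K \<phi> \<psi>)
  then show ?case by (auto intro: forces_mono)
next
  case (imp_S \<phi> \<psi> \<chi>)
  then show ?case
    unfolding forces.simps by (metis order_refl subset_trans)
next
  case (and_I \<phi> \<psi>)
  then show ?case by (auto intro: forces_mono)
next
  case (or_E \<phi> \<chi> \<psi>)
  then show ?case
    unfolding forces.simps by (metis order_refl subset_trans)
next
  \<comment> \<open>A premise from \<psi>' to \<phi>' composes with the two outer implications to
    one from \<psi> to \<phi>; this gives \<psi> and hence \<psi>'.\<close>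
  case (cimp_mono \<phi>' \<phi> \<psi> \<psi>')
  then show ?case
    unfolding forces.simps by (smt (verit) order_refl subset_trans)
next
  case (says_mono \<phi> \<psi> A)
  then show ?case
    unfolding forces.simps by (metis order_refl subset_trans)
qed auto

text \<open>Modus ponens is the only rule, so soundness holds locally, at a single world.\<close>

lemma forces_sound:
  assumes "pcl_provable E P \<Gamma> \<phi>" "w \<in> W" "\<And>\<gamma>. \<gamma> \<in> \<Gamma> \<Longrightarrow> forces W w \<gamma>"
  shows "forces W w \<phi>"
  using assms
  by (induction rule: pcl_provable.induct) (auto intro: forces_axiom)

lemma forces_conj_list: "forces W w (conj_list \<phi>s) \<longleftrightarrow> (\<forall>\<phi>\<in>set \<phi>s. forces W w \<phi>)"
  by (induction \<phi>s rule: conj_list.induct) auto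

lemma forces_big_conj: "finite S \<Longrightarrow> forces W w (big_conj S) \<longleftrightarrow> (\<forall>\<phi>\<in>S. forces W w \<phi>)"
  by (metis big_conj_eq_conj_list forces_conj_list)

section \<open>Provable events are reachable\<close>

text \<open>\<open>X\<close> is a guess at the final configuration that justifies circular
  enablings, while ordinary ones are built up inductively from \<open>w\<close>. Asking for
  \<open>D \<subseteq> X\<close> builds saturation in, so the closure lemmas hold for arbitrary sets
  of events.\<close>

inductive_set generated :: "('e, 'p) contract \<Rightarrow> 'e set \<Rightarrow> 'e set \<Rightarrow> 'e set"
  for C w X where
  base: "a \<in> w \<Longrightarrow> a \<in> generated C w X"
| enab: "(D, a) \<in> enab C \<Longrightarrow> (\<And>d. d \<in> D \<Longrightarrow> d \<in> generated C w X) \<Longrightarrow> a \<in> generated C w X"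
| cenab: "(D, a) \<in> cenab C \<Longrightarrow> D \<subseteq> X \<Longrightarrow> a \<in> generated C w X"

text \<open>The greatest fixed point is the union of the configurations relative to the
  events in \<open>w\<close> being given.\<close>

definition reach_closure :: "('e, 'p) contract \<Rightarrow> 'e set \<Rightarrow> 'e set" where
  "reach_closure C w = gfp (generated C w)"

text \<open>Minimality of the inductive set, with both parameters varying: \<open>w\<close> may be
  replaced by any set that generates it.\<close>

lemma generated_subset:
  assumes "w \<subseteq> generated C w' X'" "X \<subseteq> X'"
  shows "generated C w X \<subseteq> generated C w' X'"
proof
  fix a assume "a \<in> generated C w X"
  then show "a \<in> generated C w' X'"
    by induction (use assms in \<open>auto intro: generated.intros\<close>)
qed

lemma mono_generated: "mono (generated C w)"
  by (rule monoI, rule generated_subset) (auto intro: generated.base)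

lemma reach_closure_unfold: "generated C w (reach_closure C w) = reach_closure C w"
  unfolding reach_closure_def by (rule gfp_unfold[OF mono_generated, symmetric])

lemma reach_closure_upperbound: "X \<subseteq> generated C w X \<Longrightarrow> X \<subseteq> reach_closure C w"
  unfolding reach_closure_def by (rule gfp_upperbound)

lemma reach_closure_base: "w \<subseteq> reach_closure C w"
  using generated.base[of _ w C "reach_closure C w"] by (auto simp: reach_closure_unfold)

text \<open>By coinduction: the events added to \<open>w\<close> are themselves generated from
  \<open>w\<close> once \<open>?X\<close> is the guess, so \<open>?X\<close> is a post-fixed point
  relative to \<open>w\<close>.\<close>

lemma reach_closure_idem: "reach_closure C (reach_closure C w) = reach_closure C w"
proof (rule antisym)
  let ?X = "reach_closure C (reach_closure C w)"
  have "reach_closure C w \<subseteq> ?X" by (rule reach_closure_base)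
  then have "generated C w (reach_closure C w) \<subseteq> generated C w ?X"
    by (rule monoD[OF mono_generated])
  then have "reach_closure C w \<subseteq> generated C w ?X"
    by (simp only: reach_closure_unfold)
  then have "generated C (reach_closure C w) ?X \<subseteq> generated C w ?X"
    by (rule generated_subset) simp
  then have "?X \<subseteq> generated C w ?X"
    by (simp only: reach_closure_unfold)
  then show "?X \<subseteq> reach_closure C w"
    by (rule reach_closure_upperbound)
qed (rule reach_closure_base)

lemma reach_closed_enab:
  assumes "reach_closure C w = w" "(D, a) \<in> enab C" "D \<subseteq> w"
  shows "a \<in> w"
proof -
  have "generated C w w = w"
    using reach_closure_unfold[of C w] by (simp only: assms(1))
  with generated.enab[OF assms(2), of w w] assms(3) show ?thesis by auto
qed

text \<open>The circular step: since \<open>D\<close> lies in \<open>?X\<close>, the guess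
  \<open>?X\<close> generates \<open>a\<close> without \<open>a\<close> being given. Thus
  \<open>?X\<close> is a post-fixed point relative to \<open>w\<close> alone and adds nothing to
  \<open>w\<close>.\<close>

lemma reach_closed_cenab:
  assumes "reach_closure C w = w" "(D, a) \<in> cenab C" "D \<subseteq> reach_closure C (insert a w)"
  shows "a \<in> w"
proof -
  let ?X = "reach_closure C (insert a w)"
  have "generated C (insert a w) ?X \<subseteq> generated C w ?X"
    by (rule generated_subset) (use assms(2,3) in \<open>auto intro: generated.base generated.cenab\<close>)
  then have "?X \<subseteq> reach_closure C w"
    by (intro reach_closure_upperbound) (simp only: reach_closure_unfold)
  then have "?X \<subseteq> w"
    by (simp only: assms(1))
  then show ?thesis
    using reach_closure_base[of "insert a w" C] by blast
qed

lemma forces_contract_formula: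
  assumes C: "is_contract C" and w: "reach_closure C w = w"
  shows "forces {v. reach_closure C v = v} w (contract_formula C)"
proof -
  let ?W = "{v. reach_closure C v = v}"
  have claims: "forces ?W v (big_conj (claim C ` D)) \<longleftrightarrow> D \<subseteq> v" if "D \<subseteq> events C" for v D
    by (simp add: forces_big_conj[OF finite_claims[OF C that]] subset_eq)
  have "forces ?W w (clause Imp (owner C) D a)" if "(D, a) \<in> enab C" for D a
    using reach_closed_enab[OF _ that] is_contractD(3)[OF C that]
    unfolding clause_def forces.simps by (simp add: claims)
  moreover have "forces ?W w (clause CImp (owner C) D a)" if "(D, a) \<in> cenab C" for D a
  proof -
    have *: "a \<in> v" if v: "v \<in> ?W" and *: "\<forall>u\<in>?W. v \<subseteq> u \<longrightarrow> a \<in> u \<longrightarrow> D \<subseteq> u" for v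
    proof (rule reach_closed_cenab)
      \<comment> \<open>The hypothesis is tested at this set, which idempotence makes a world; it
        lies above \<open>v\<close> and contains \<open>a\<close>.\<close>
      show "D \<subseteq> reach_closure C (insert a v)"
        using *[rule_format, of "reach_closure C (insert a v)"]
          reach_closure_base[of "insert a v" C]
        by (simp add: reach_closure_idem)
    qed (use v \<open>(D, a) \<in> cenab C\<close> in auto)
    have D: "D \<subseteq> events C"
      using is_contractD(4)[OF C that] by simp
    show ?thesis
      unfolding clause_def forces.simps claims[OF D] by (blast intro: *)
  qed
  ultimately show ?thesis
    unfolding contract_formula_eq forces_big_conj[OF finite_clauses[OF C]]
    by (auto simp: clauses_def)
qed

text \<open>The list condition of \<open>configuration\<close>, with \<open>X\<close> decoupled from
  the set of the list, so that lists can be assembled piecewise while circular enablings already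
  refer to the final set.\<close>

definition justified :: "('e, 'p) contract \<Rightarrow> 'e set \<Rightarrow> 'e list \<Rightarrow> bool" where
  "justified C X es \<longleftrightarrow> (\<forall>i < length es.
     (set (take i es), es ! i) \<in> enab C \<or> (X, es ! i) \<in> cenab C)"

text \<open>Prefixes of the second list grow by all of \<open>es\<close>, which saturation of
  \<open>enab C\<close> tolerates; circular enablings only look at \<open>X\<close>. Repeated events
  are allowed.\<close>

lemma justified_append:
  assumes C: "is_contract C" and "justified C X es" "justified C X es'"
    and "set es \<subseteq> events C" "set es' \<subseteq> events C"
  shows "justified C X (es @ es')"
  unfolding justified_def
proof (intro allI impI)
  fix i assume i: "i < length (es @ es')"
  show "(set (take i (es @ es')), (es @ es') ! i) \<in> enab C \<or> (X, (es @ es') ! i) \<in> cenab C"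
  proof (cases "i < length es")
    case True
    then show ?thesis using assms(2) by (simp add: justified_def nth_append)
  next
    case False
    let ?j = "i - length es"
    have *: "(set (take ?j es'), es' ! ?j) \<in> enab C \<or> (X, es' ! ?j) \<in> cenab C"
      using False i assms(3) by (simp add: justified_def)
    have sub: "set (take ?j es') \<subseteq> set (take i (es @ es'))"
      using False by simp
    have E: "set (take i (es @ es')) \<subseteq> events C"
      by (rule subset_trans[OF set_take_subset]) (use assms(4,5) in simp)
    have "(es @ es') ! i = es' ! ?j"
      using False by (simp add: nth_append)
    with * is_contractD(5)[OF C _ sub E] show ?thesis
      by metis
  qed
qed

lemma justified_snoc:
  "justified C X es \<Longrightarrow> (set es, a) \<in> enab C \<or> (X, a) \<in> cenab C \<Longrightarrow> justified C X (es @ [a])"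
  by (auto simp: justified_def nth_append less_Suc_eq)

lemma justified_cover:
  assumes C: "is_contract C" and "X \<subseteq> events C" "finite Y"
    and "\<And>a. a \<in> Y \<Longrightarrow> \<exists>es. justified C X es \<and> set es \<subseteq> X \<and> a \<in> set es"
  shows "\<exists>es. justified C X es \<and> set es \<subseteq> X \<and> Y \<subseteq> set es"
  using assms(3,4)
proof (induction Y rule: finite_induct)
  case empty
  show ?case by (rule exI[of _ "[]"]) (auto simp: justified_def)
next
  case (insert a Y)
  then obtain es es' where "justified C X es" "set es \<subseteq> X" "Y \<subseteq> set es"
    "justified C X es'" "set es' \<subseteq> X" "a \<in> set es'"
    by (metis insertI1 insertI2)
  then show ?case
    using justified_append[OF C, of X es es'] assms(2)
    by (intro exI[of _ "es @ es'"]) auto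
qed

text \<open>Induction on generation gives every element of the closure a justified list inside it;
  by finiteness these concatenate to a list of the whole closure.\<close>

lemma configuration_reach_closure:
  assumes C: "is_contract C"
  shows "configuration C (reach_closure C {})"
proof -
  define X where "X = reach_closure C {}"
  have gen: "generated C {} X = X"
    unfolding X_def by (rule reach_closure_unfold)
  have E: "X \<subseteq> events C"
  proof
    fix a assume "a \<in> X"
    then have "a \<in> generated C {} X" by (simp only: gen)
    then show "a \<in> events C"
    proof cases
      case (enab D)
      then show ?thesis using is_contractD(3)[OF C] by blast
    next
      case (cenab D)
      then show ?thesis using is_contractD(4)[OF C] by blast
    qed simp
  qed
  have "\<exists>es. justified C X es \<and> set es \<subseteq> X \<and> a \<in> set es" if "a \<in> generated C {} X" for a
    using that
  proof induction
    case (enab D a)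
    have "finite D"
      using is_contractD(3)[OF C enab(1)] finite_subset[OF _ is_contractD(1)[OF C]] by simp
    then obtain es where es: "justified C X es" "set es \<subseteq> X" "D \<subseteq> set es"
      using justified_cover[OF C E _ enab(3)] by metis
    then have "(set es, a) \<in> enab C"
      using is_contractD(5)[OF C enab(1), of "set es"] E by simp
    moreover have "a \<in> generated C {} X"
      by (rule generated.enab[OF enab(1,2)])
    ultimately show ?case
      using es justified_snoc[OF es(1)] by (intro exI[of _ "es @ [a]"]) (simp add: gen)
  next
    case (cenab D a)
    have "(X, a) \<in> cenab C"
      by (rule is_contractD(6)[OF C cenab E])
    moreover have "a \<in> generated C {} X"
      by (rule generated.cenab[OF cenab])
    ultimately show ?case
      by (intro exI[of _ "[a]"]) (simp add: justified_def gen)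
  qed simp
  then obtain es where "justified C X es" "set es \<subseteq> X" "X \<subseteq> set es"
    using justified_cover[OF C E finite_subset[OF E is_contractD(1)[OF C]]] unfolding gen by metis
  then show ?thesis
    using E unfolding configuration_def justified_def X_def[symmetric] by blast
qed

theorem theorem2:
  fixes C :: "('e, 'p) contract" and e :: 'e
  assumes "is_contract C" and "e \<in> events C"
  shows "reachable C e \<longleftrightarrow>
    pcl_provable (events C) (participants C) {contract_formula C} (owner C e says Atom e)"
proof
  assume "reachable C e"
  with assms(1) show "pcl_provable (events C) (participants C) {contract_formula C} (claim C e)"
    by (rule reachable_imp_provable)
next
  let ?R = "reach_closure C {}"
  assume "pcl_provable (events C) (participants C) {contract_formula C} (claim C e)"
  \<comment> \<open>Soundness is applied at the closure of the empty set; since \<open>says\<close>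
    is the identity, forcing the claim there means that \<open>e\<close> belongs to it.\<close>
  then have "forces {v. reach_closure C v = v} ?R (claim C e)"
    by (rule forces_sound)
      (use forces_contract_formula[OF assms(1), of ?R] in \<open>simp_all add: reach_closure_idem\<close>)
  then show "reachable C e"
    using configuration_reach_closure[OF assms(1)] by (auto simp: reachable_def)
qed

end
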